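(* Let $n,k\in\mathbb{N}$, $\varepsilon>0$, and $\tilde d_{max}\in\mathbb{Z}_{\ge 0}$. Then the algorithm $\mathsf{LocalLap}_{k\star}$ (with inputs $\varepsilon$ and $\tilde d_{max}$) provides $\varepsilon$-edge LDP; that is, for every $i\in[n]$, the randomized algorithm $\mathcal{R}_i:\mathbf{a}_i\mapsto \hat r_i$ run by user $v_i$ provides $\varepsilon$-edge LDP.
   Context: $[n]=\{1,\dots,n\}$; $\mathbb N=\{1,2,\dots\}$. Graphs are undirected on nodes (users) $v_1,\dots,v_n$, with symmetric adjacency matrix $\mathbf{A}=(a_{i,j})\in\{0,1\}^{n\times n}$. The neighbor list of $v_i$ is the $i$-th row $\mathbf{a}_i=(a_{i,1},\dots,a_{i,n})\in\{0,1\}^n$. $\varepsilon$-edge LDP: a randomized algorithm $\mathcal{R}_i$ with domain $\{0,1\}^n$ provides $\varepsilon$-edge LDP if for any two neighbor lists $\mathbf{a}_i,\mathbf{a}_i'\in\{0,1\}^n$ that differ in one bit and any (measurable) $S\subseteq \mathrm{Range}(\mathcal{R}_i)$, $\Pr[\mathcal{R}_i(\mathbf{a}_i)\in S]\le e^{\varepsilon}\Pr[\mathcal{R}_i(\mathbf{a}_i')\in S]$. $\mathrm{Lap}(b)$ denotes a Laplace random variable with mean $0$ and scale $b$ (with $\mathrm{Lap}(0)=0$). Graph projection: given a neighbor list $\mathbf{a}_i$ with $d_i$ ones and $\tilde d_{max}$, if $d_i>\tilde d_{max}$ then $\tilde d_{max}$ of the $d_i$ neighbors are selected uniformly at random and the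 other ones are set to $0$; otherwise $\mathbf{a}_i$ is unchanged. Algorithm $\mathsf{LocalLap}_{k\star}$: let $\Delta=\binom{\tilde d_{max}}{k-1}$. Each user $v_i$ independently applies graph projection with $\tilde d_{max}$ to $\mathbf{a}_i$, lets $d_i=\sum_{j=1}^n a_{i,j}$ (after projection) and $r_i=\binom{d_i}{k}$, and releases $\hat r_i=r_i+\mathrm{Lap}(\Delta/\varepsilon)$. The data collector outputs $\sum_{i=1}^n\hat r_i$. *)

theory Defs
  imports "HOL-Probability.Probability"
begin

text \<open>
  A neighbor list in \<open>{0,1}\<^sup>n\<close> is a function on \<open>{1..n}\<close>, extensional outside that index set,
  so that equality of lists is equality of their \<open>n\<close> bits.
\<close>

type_synonym neighbor_list = "nat \<Rightarrow> nat"

definition neighbor_lists :: "nat \<Rightarrow> neighbor_list set" where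
  "neighbor_lists n = ({1..n} \<rightarrow>\<^sub>E {0, 1})"

definition degree :: "nat \<Rightarrow> neighbor_list \<Rightarrow> nat" where
  "degree n a = (\<Sum>j = 1..n. a j)"

definition differ_in_one_bit :: "nat \<Rightarrow> neighbor_list \<Rightarrow> neighbor_list \<Rightarrow> bool" where
  "differ_in_one_bit n a a' \<longleftrightarrow> card {j \<in> {1..n}. a j \<noteq> a' j} = 1"

text \<open>
  A randomized algorithm with domain \<open>{0,1}\<^sup>n\<close> and outputs in the measurable space \<open>M\<close> sends each
  list to the probability distribution on \<open>M\<close> of its output. The first conjunct of
  \<open>edge_LDP\<close> requires \<open>R\<close> to be such an algorithm; without it the inequality could
  hold for degenerate reasons.
\<close>

definition edge_LDP ::
    "nat \<Rightarrow> 'b measure \<Rightarrow> real \<Rightarrow> (neighbor_list \<Rightarrow> 'b measure) \<Rightarrow> bool" where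
  "edge_LDP n M \<epsilon> R \<longleftrightarrow>
     (\<forall>a \<in> neighbor_lists n. R a \<in> space (prob_algebra M)) \<and>
     (\<forall>a \<in> neighbor_lists n. \<forall>a' \<in> neighbor_lists n. differ_in_one_bit n a a' \<longrightarrow>
        (\<forall>S \<in> sets M. measure (R a) S \<le> exp \<epsilon> * measure (R a') S))"

text \<open>Only scales \<open>b \<ge> 0\<close> are meaningful; scale \<open>0\<close> is the point mass at \<open>0\<close>.\<close>

definition Lap :: "real \<Rightarrow> real measure" where
  "Lap b = (if b = 0 then return borel 0
            else density lborel (\<lambda>x. ennreal (exp (- \<bar>x\<bar> / b) / (2 * b))))"

definition graph_projection :: "nat \<Rightarrow> nat \<Rightarrow> neighbor_list \<Rightarrow> neighbor_list pmf" where
  "graph_projection n dmax a =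
     (if degree n a > dmax
      then map_pmf (\<lambda>T. \<lambda>j\<in>{1..n}. if j \<in> T then 1 else 0)
             (pmf_of_set {T. T \<subseteq> {j \<in> {1..n}. a j = 1} \<and> card T = dmax})
      else return_pmf a)"

text \<open>
  A one-round protocol: user \<open>i\<close> applies \<open>randomizer i\<close> to their own neighbor list, with randomness
  independent of the other users', and the collector combines the \<open>n\<close> released values.
\<close>

record protocol =
  randomizer :: "nat \<Rightarrow> neighbor_list \<Rightarrow> real measure"
  collector :: "(nat \<Rightarrow> real) \<Rightarrow> real"

definition LocalLap_kstar :: "nat \<Rightarrow> nat \<Rightarrow> real \<Rightarrow> nat \<Rightarrow> protocol" where
  "LocalLap_kstar n k \<epsilon> dmax =
     (let \<Delta> = real (dmax choose (k - 1)) in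
      \<lparr> randomizer = (\<lambda>i a.
          bind (measure_pmf (graph_projection n dmax a)) (\<lambda>a\<^sub>p.
            distr (Lap (\<Delta> / \<epsilon>)) borel (\<lambda>x. real (degree n a\<^sub>p choose k) + x))),
        collector = (\<lambda>r. \<Sum>i = 1..n. r i) \<rparr>)"

text \<open>Edge LDP of a protocol is a condition on each user's randomizer; the collector is untrusted.\<close>

definition protocol_edge_LDP :: "nat \<Rightarrow> real \<Rightarrow> protocol \<Rightarrow> bool" where
  "protocol_edge_LDP n \<epsilon> P \<longleftrightarrow> (\<forall>i \<in> {1..n}. edge_LDP n borel \<epsilon> (randomizer P i))"

end

theory Submission
  imports Defs
begin

text \<open>
  The released value depends on the neighbor list only through the degree after projection, which
  is deterministically \<open>min d dmax\<close>. Flipping one bit changes this number by at most one, hence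
  by Pascal's rule changes the \<open>k\<close>-star count by at most \<open>\<Delta>\<close>, and Laplace noise of scale
  \<open>\<Delta> / \<epsilon>\<close> hides a shift of that size up to a factor \<open>exp \<epsilon>\<close>. When \<open>\<Delta> = 0\<close> there is no
  noise, but the counts coincide.
\<close>

lemma sets_Lap [measurable_cong, simp]: "sets (Lap b) = sets borel"
  by (simp add: Lap_def)

lemma space_Lap [simp]: "space (Lap b) = UNIV"
  by (simp add: Lap_def)

text \<open>For positive \<open>b\<close> the density is the average of the exponential density of
  rate \<open>1 / b\<close> and its mirror image, and each of these integrates to 1.\<close>

lemma prob_space_Lap:
  assumes "b \<ge> 0"
  shows "prob_space (Lap b)"
proof (cases "b = 0")
  case True
  then show ?thesis
    by (simp add: Lap_def prob_space_return)
next
  case False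
  with assms have b: "b > 0" by simp
  interpret E: prob_space "density lborel (exponential_density (1 / b))"
    using b by (intro prob_space_exponential_density) simp
  have half: "(\<integral>\<^sup>+x. ennreal (exponential_density (1 / b) x) \<partial>lborel) = 1"
    using E.emeasure_space_1 by (simp add: emeasure_density)
  have refl: "(\<integral>\<^sup>+x. ennreal (exponential_density (1 / b) (- x)) \<partial>lborel) = 1"
    using nn_integral_real_affine[of "\<lambda>x. ennreal (exponential_density (1 / b) x)" "-1" 0] half
    by simp
  \<comment> \<open>Only almost everywhere: at 0 both exponential densities equal
    \<open>1 / b\<close>, so their average is twice the Laplace density there.\<close>
  have split: "AE x in lborel. ennreal (exp (- \<bar>x\<bar> / b) / (2 * b)) =
      ennreal (1 / 2) * (ennreal (exponential_density (1 / b) x)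
        + ennreal (exponential_density (1 / b) (- x)))"
    using AE_lborel_singleton[of 0]
  proof eventually_elim
    case (elim x)
    then have "exponential_density (1 / b) x + exponential_density (1 / b) (- x)
        = exp (- \<bar>x\<bar> / b) / b"
      by (auto simp: exponential_density_def)
    moreover have "exponential_density (1 / b) y \<ge> 0" for y
      using b by (simp add: exponential_density_def)
    ultimately show ?case
      using b by (simp flip: ennreal_plus ennreal_mult' del: ennreal_half)
  qed
  have "(\<integral>\<^sup>+x. ennreal (exp (- \<bar>x\<bar> / b) / (2 * b)) \<partial>lborel) = ennreal (1 / 2) * (1 + 1)"
    by (subst nn_integral_cong_AE[OF split])
      (simp add: nn_integral_cmult nn_integral_add half refl)
  also have "\<dots> = ennreal (1 / 2 * 2)"
    by (subst ennreal_mult') auto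
  finally have "(\<integral>\<^sup>+x. ennreal (exp (- \<bar>x\<bar> / b) / (2 * b)) \<partial>lborel) = 1"
    by simp
  with False show ?thesis
    by (intro prob_spaceI) (simp add: Lap_def emeasure_density)
qed

lemma shifted_Lap_in_prob_algebra:
  assumes "b \<ge> 0"
  shows "distr (Lap b) borel (\<lambda>x. c + x) \<in> space (prob_algebra borel)"
  using prob_space.prob_space_distr[OF prob_space_Lap[OF assms], of "\<lambda>x. c + x" borel]
  by (simp add: space_prob_algebra)

text \<open>Translation invariance of Lebesgue measure moves the shift from the event into the
  density, so that two shifts can be compared pointwise over the same \<open>S\<close>.\<close>

lemma emeasure_shifted_Lap:
  assumes "b \<noteq> 0" and "S \<in> sets borel"
  shows "emeasure (distr (Lap b) borel (\<lambda>x. c + x)) S =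
    (\<integral>\<^sup>+x. ennreal (exp (- \<bar>x - c\<bar> / b) / (2 * b)) * indicator S x \<partial>lborel)"
proof -
  have S [measurable]: "S \<in> sets borel" by fact
  have "emeasure (distr (Lap b) borel (\<lambda>x. c + x)) S = emeasure (Lap b) ((\<lambda>x. c + x) -` S)"
    by (subst emeasure_distr) auto
  also have "\<dots> = (\<integral>\<^sup>+x. ennreal (exp (- \<bar>x\<bar> / b) / (2 * b)) * indicator S (c + x) \<partial>lborel)"
    using assms measurable_sets_borel[of "\<lambda>x. c + x" borel S]
    by (simp add: Lap_def emeasure_density indicator_def vimage_def)
  also have "\<dots> = (\<integral>\<^sup>+x. ennreal (exp (- \<bar>x - c\<bar> / b) / (2 * b)) * indicator S x \<partial>lborel)"
    by (subst nn_integral_real_affine[where c = 1 and t = c]) auto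
  finally show ?thesis .
qed

text \<open>By the triangle inequality the two densities differ at every point by a factor of at
  most \<open>exp \<epsilon>\<close>; integrating over \<open>S\<close> keeps the factor. Bounding
  the shift by a product instead of a quotient makes \<open>b = 0\<close> force
  \<open>c = c'\<close>.\<close>

lemma laplace_mechanism:
  assumes \<epsilon>: "\<epsilon> \<ge> 0" and b: "b \<ge> 0" and shift: "\<bar>c - c'\<bar> \<le> \<epsilon> * b" and S: "S \<in> sets borel"
  shows "measure (distr (Lap b) borel (\<lambda>x. c + x)) S
    \<le> exp \<epsilon> * measure (distr (Lap b) borel (\<lambda>x. c' + x)) S"
proof -
  let ?L = "\<lambda>c. distr (Lap b) borel (\<lambda>x. c + x)"
  have fin: "finite_measure (?L c)" for c
    using shifted_Lap_in_prob_algebra[OF b, of c]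
    by (simp add: space_prob_algebra prob_space.finite_measure)
  have "emeasure (?L c) S \<le> ennreal (exp \<epsilon>) * emeasure (?L c') S"
  proof (cases "b = 0")
    case True
    \<comment> \<open>Both sides concern the same point mass here, so
      \<open>1 \<le> exp \<epsilon>\<close> suffices.\<close>
    have "1 * emeasure (?L c') S \<le> ennreal (exp \<epsilon>) * emeasure (?L c') S"
      using \<epsilon> by (intro mult_right_mono) (auto simp flip: ennreal_1)
    with True shift show ?thesis by simp
  next
    case False
    with b have b: "b > 0" by simp
    have dens: "exp (- \<bar>x - c\<bar> / b) / (2 * b) \<le> exp \<epsilon> * (exp (- \<bar>x - c'\<bar> / b) / (2 * b))" for x
    proof -
      have "\<bar>x - c'\<bar> \<le> \<bar>x - c\<bar> + \<epsilon> * b" using shift by linarith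
      then have "- \<bar>x - c\<bar> / b \<le> \<epsilon> + - \<bar>x - c'\<bar> / b"
        using b by (simp add: field_simps)
      then have "exp (- \<bar>x - c\<bar> / b) \<le> exp \<epsilon> * exp (- \<bar>x - c'\<bar> / b)"
        by (simp flip: exp_add)
      then show ?thesis
        using b by (simp add: divide_right_mono)
    qed
    have "emeasure (?L c) S \<le> (\<integral>\<^sup>+x. ennreal (exp \<epsilon>) *
        (ennreal (exp (- \<bar>x - c'\<bar> / b) / (2 * b)) * indicator S x) \<partial>lborel)"
      unfolding emeasure_shifted_Lap[OF False S]
      using dens b by (intro nn_integral_mono)
        (auto simp: indicator_def simp flip: ennreal_mult intro!: ennreal_leI)
    also have "\<dots> = ennreal (exp \<epsilon>) * emeasure (?L c') S"
      unfolding emeasure_shifted_Lap[OF False S] using S by (intro nn_integral_cmult) auto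
    finally show ?thesis .
  qed
  then show ?thesis
    by (simp add: finite_measure.emeasure_eq_measure[OF fin] flip: ennreal_mult)
qed

lemma neighbor_lists_bit:
  assumes "a \<in> neighbor_lists n" and "j \<in> {1..n}"
  shows "a j = 0 \<or> a j = 1"
  using PiE_mem[OF assms[unfolded neighbor_lists_def]] by simp

lemma degree_eq_card:
  assumes "a \<in> neighbor_lists n"
  shows "degree n a = card {j \<in> {1..n}. a j = 1}"
proof -
  have "degree n a = (\<Sum>j\<in>{1..n}. if a j = 1 then 1 else 0)"
    unfolding degree_def using neighbor_lists_bit[OF assms] by (intro sum.cong) fastforce+
  then show ?thesis
    by (simp flip: sum.inter_filter)
qed

text \<open>Whichever subset is drawn, its size is fixed, so the randomness of the projection does
  not reach the degree.\<close>

lemma degree_graph_projection: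
  assumes a: "a \<in> neighbor_lists n" and p: "p \<in> set_pmf (graph_projection n dmax a)"
  shows "degree n p = min (degree n a) dmax"
proof (cases "degree n a > dmax")
  case True
  let ?A = "{j \<in> {1..n}. a j = 1}"
  let ?T = "{T. T \<subseteq> ?A \<and> card T = dmax}"
  \<comment> \<open>The support of \<open>pmf_of_set\<close> is the given set only when that set is
    finite and nonempty.\<close>
  have "finite ?T"
    by (rule finite_subset[of _ "Pow ?A"]) auto
  moreover have "?T \<noteq> {}"
    using True obtain_subset_with_card_n[of dmax ?A] degree_eq_card[OF a] by fastforce
  ultimately obtain T where T: "T \<subseteq> ?A" "card T = dmax"
    and p_def: "p = (\<lambda>j\<in>{1..n}. if j \<in> T then 1 else 0)"
    using p True by (auto simp: graph_projection_def)
  have "degree n p = (\<Sum>j\<in>{1..n}. if j \<in> T then 1 else 0)"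
    unfolding degree_def p_def by (intro sum.cong) auto
  also have "\<dots> = card {j \<in> {1..n}. j \<in> T}"
    by (simp flip: sum.inter_filter)
  also have "{j \<in> {1..n}. j \<in> T} = T"
    using T by auto
  finally show ?thesis
    using T True by simp
next
  case False
  with p show ?thesis
    by (simp add: graph_projection_def)
qed

lemma degree_differ_in_one_bit:
  assumes a: "a \<in> neighbor_lists n" and a': "a' \<in> neighbor_lists n"
    and diff: "differ_in_one_bit n a a'"
  shows "degree n a' = Suc (degree n a) \<or> degree n a = Suc (degree n a')"
proof -
  obtain j where j: "{i \<in> {1..n}. a i \<noteq> a' i} = {j}"
    using diff by (auto simp: differ_in_one_bit_def card_1_singleton_iff)
  then have j_mem: "j \<in> {1..n}" and neq: "a j \<noteq> a' j" by auto
  have "(\<Sum>i\<in>{1..n} - {j}. a i) = (\<Sum>i\<in>{1..n} - {j}. a' i)"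
    using j by (intro sum.cong) auto
  \<comment> \<open>Adding the opposite bit on each side avoids truncated subtraction on the
    naturals.\<close>
  then have "degree n a + a' j = degree n a' + a j"
    using j_mem unfolding degree_def by (subst (1 2) sum.remove[of "{1..n}" j]) auto
  with neq neighbor_lists_bit[OF a j_mem] neighbor_lists_bit[OF a' j_mem] show ?thesis
    by auto
qed

text \<open>Below \<open>D\<close>, Pascal's rule gives the increment
  \<open>d choose (k - 1)\<close>, which is monotone in \<open>d\<close>; from \<open>D\<close> on,
  both minima equal \<open>D\<close>.\<close>

lemma choose_min_Suc_diff:
  assumes "k \<ge> 1"
  shows "\<bar>real (min (Suc d) D choose k) - real (min d D choose k)\<bar> \<le> real (D choose (k - 1))"
proof (cases "d < D")
  case True
  obtain k' where k: "k = Suc k'" using assms by (cases k) auto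
  have "d choose k' \<le> D choose k'"
    using True by (intro binomial_right_mono) simp
  then show ?thesis
    using True by (simp add: k)
qed simp

text \<open>All lists in the support of the projection have the same degree, so the bind is over a
  constant kernel and collapses to a single shifted Laplace distribution.\<close>

lemma randomizer_LocalLap_kstar:
  assumes \<epsilon>: "\<epsilon> > 0" and a: "a \<in> neighbor_lists n"
  shows "randomizer (LocalLap_kstar n k \<epsilon> dmax) i a =
    distr (Lap (real (dmax choose (k - 1)) / \<epsilon>)) borel
      (\<lambda>x. real (min (degree n a) dmax choose k) + x)"
    (is "_ = ?N")
proof -
  let ?b = "real (dmax choose (k - 1)) / \<epsilon>"
  have sub: "distr (Lap ?b) borel (\<lambda>x. c + x) \<in> space (subprob_algebra borel)" for c
    using shifted_Lap_in_prob_algebra[of ?b c] \<epsilon>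
    by (auto simp: space_prob_algebra space_subprob_algebra prob_space_imp_subprob_space)
  have "randomizer (LocalLap_kstar n k \<epsilon> dmax) i a =
      measure_pmf (graph_projection n dmax a) \<bind> (\<lambda>_. ?N)"
    unfolding LocalLap_kstar_def Let_def protocol.simps
    using sub degree_graph_projection[OF a] by (intro bind_measure_pmf_cong) auto
  also have "\<dots> = ?N"
    using sub by (intro bind_const')
      (auto simp: space_subprob_algebra measure_pmf.prob_space_axioms)
  finally show ?thesis .
qed

theorem theorem1:
  fixes n k dmax :: nat and \<epsilon> :: real
  assumes "n \<ge> 1" and "k \<ge> 1" and "\<epsilon> > 0"
  shows "protocol_edge_LDP n \<epsilon> (LocalLap_kstar n k \<epsilon> dmax)"
proof -
  let ?b = "real (dmax choose (k - 1)) / \<epsilon>"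
  let ?r = "\<lambda>a. real (min (degree n a) dmax choose k)"
  have b: "?b \<ge> 0" using \<open>\<epsilon> > 0\<close> by simp
  \<comment> \<open>The right side is just \<open>dmax choose (k - 1)\<close>. Either list may have
    the larger degree, hence the two instances of \<open>choose_min_Suc_diff\<close>.\<close>
  have sensitivity: "\<bar>?r a - ?r a'\<bar> \<le> \<epsilon> * ?b"
    if "a \<in> neighbor_lists n" "a' \<in> neighbor_lists n" "differ_in_one_bit n a a'" for a a'
    using degree_differ_in_one_bit[OF that] \<open>\<epsilon> > 0\<close>
      choose_min_Suc_diff[OF \<open>k \<ge> 1\<close>, of "degree n a" dmax]
      choose_min_Suc_diff[OF \<open>k \<ge> 1\<close>, of "degree n a'" dmax]
    by (auto simp: abs_minus_commute)
  show ?thesis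
    unfolding protocol_edge_LDP_def edge_LDP_def
    using laplace_mechanism[OF less_imp_le[OF \<open>\<epsilon> > 0\<close>] b sensitivity]
      shifted_Lap_in_prob_algebra[OF b]
    by (simp add: randomizer_LocalLap_kstar[OF \<open>\<epsilon> > 0\<close>])
qed

end
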